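(* Let $V$ be a real inner product space, $\mathfrak g\subseteq V$ a real linear subspace, $l_0\in V$, and $P\in\mathfrak g$. If the residual $R:=l_0-P$ satisfies $\langle R,Y\rangle=0$ for all $Y\in\mathfrak g$, then $P$ is the unique minimizer of $\|l-l_0\|^2$ over $l\in\mathfrak g$; that is, $P=\mathrm{proj}_{\mathfrak g}(l_0)$.
   Context: $\|\cdot\|$ is the norm induced by the inner product $\langle\cdot,\cdot\rangle$ of $V$. $P=\mathrm{proj}_{\mathfrak g}(l_0)$ means that $P$ is the orthogonal projection of $l_0$ onto $\mathfrak g$, i.e. the unique element of $\mathfrak g$ closest to $l_0$. *)

theory Defs
  imports "HOL-Analysis.Inner_Product"
begin

(* The library function closest_point additionally requires the class heine_borel,
   which for real normed spaces means finite dimension; the ambient space here is an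
   arbitrary real inner product space. The value is meaningful only when a closest
   point exists and is unique. *)
definition proj :: "'a::real_inner set \<Rightarrow> 'a \<Rightarrow> 'a" where
  "proj G l0 = (THE p. is_arg_min (\<lambda>l. dist l0 l) (\<lambda>l. l \<in> G) p)"

end

theory Submission
  imports Defs
begin

text \<open>
  For \<open>l\<close> in the subspace, the vector \<open>l - P\<close> lies in the subspace as well and is therefore
  orthogonal to the residual \<open>l0 - P\<close>. By Pythagoras the squared distance from \<open>l\<close> to \<open>l0\<close> is
  the squared distance from \<open>P\<close> to \<open>l0\<close> plus the squared length of \<open>l - P\<close>
  (\<open>residual_orthogonal_pythagoras\<close>). The excess is nonnegative and vanishes only at \<open>l = P\<close>,
  which gives minimality and uniqueness together. Squaring is strictly monotone on nonnegative
  reals, so the distance and its square have the same minimizers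
  (\<open>is_arg_min_dist_iff_norm_square\<close>), and \<open>P\<close> is also the closest point selected by
  \<open>proj\<close>.
\<close>

lemma residual_orthogonal_pythagoras:
  fixes G :: "'v::real_inner set"
  assumes "subspace G" "P \<in> G" "\<forall>Y\<in>G. inner (l0 - P) Y = 0" "l \<in> G"
  shows "(norm (l - l0))\<^sup>2 = (norm (P - l0))\<^sup>2 + (norm (l - P))\<^sup>2"
proof -
  have "inner (l0 - P) (l - P) = 0"
    using assms by (simp add: subspace_diff)
  then show ?thesis
    by (simp add: power2_norm_eq_inner inner_diff_left inner_diff_right inner_commute)
qed

lemma is_arg_min_dist_iff_norm_square:
  fixes l0 :: "'v::real_normed_vector"
  shows "is_arg_min (\<lambda>l. dist l0 l) S p \<longleftrightarrow> is_arg_min (\<lambda>l. (norm (l - l0))\<^sup>2) S p"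
proof -
  have "(norm (l - l0))\<^sup>2 < (norm (m - l0))\<^sup>2 \<longleftrightarrow> dist l0 l < dist l0 m" for l m
    by (simp add: dist_norm norm_minus_commute power_mono_iff flip: not_le)
  then show ?thesis
    by (simp add: is_arg_min_def)
qed

theorem lemma2:
  fixes G :: "'v::real_inner set" and l0 P :: 'v
  assumes "subspace G"
    and "P \<in> G"
    and "\<forall>Y\<in>G. inner (l0 - P) Y = 0"
  shows "is_arg_min (\<lambda>l. (norm (l - l0))\<^sup>2) (\<lambda>l. l \<in> G) P \<and>
         (\<forall>Q. is_arg_min (\<lambda>l. (norm (l - l0))\<^sup>2) (\<lambda>l. l \<in> G) Q \<longrightarrow> Q = P) \<and>
         P = proj G l0"
proof -
  let ?min = "is_arg_min (\<lambda>l. (norm (l - l0))\<^sup>2) (\<lambda>l. l \<in> G)"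
  note pyth = residual_orthogonal_pythagoras[OF assms]
  have "(norm (P - l0))\<^sup>2 \<le> (norm (l - l0))\<^sup>2" if "l \<in> G" for l
    using pyth[OF that] zero_le_power2[of "norm (l - P)"] by linarith
  with assms(2) have minimal: "?min P"
    by (simp add: is_arg_min_linorder)
  have unique: "Q = P" if "?min Q" for Q
  proof -
    from that assms(2) have "Q \<in> G" "(norm (Q - l0))\<^sup>2 \<le> (norm (P - l0))\<^sup>2"
      by (auto simp: is_arg_min_linorder)
    with pyth[of Q] have "(norm (Q - P))\<^sup>2 \<le> 0"
      by simp
    then show ?thesis
      by simp
  qed
  have "proj G l0 = P"
    unfolding proj_def is_arg_min_dist_iff_norm_square
    using minimal unique by (rule the_equality)
  with minimal unique show ?thesis
    by blast
qed

end
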